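(* Let $X$ be an absolutely continuous non-negative random variable with pdf $f$ and cdf $F$. If the weighted interval extropy $IJ^w(t_1,t_2)$ is increasing in $t_2$ (that is, for any fixed $t_1$, $IJ^w(t_1,t_2)$ is increasing with respect to $t_2$), then $$IJ^w(t_1,t_2)\le -\frac{t_2\,h_2(t_1,t_2)}{4}$$ for all $(t_1,t_2)\in D$.
   Context: Let $D=\{(u,v)\in\mathbb R_+^2: F(u)<F(v)\}$. For $(t_1,t_2)\in D$: - the weighted interval extropy of $X$ is $IJ^w(t_1,t_2)=-\frac{1}{2(F(t_2)-F(t_1))^2}\int_{t_1}^{t_2} x f^2(x)\,dx$; - the generalized failure rate functions of $X$ are $h_i(t_1,t_2)=\frac{f(t_i)}{F(t_2)-F(t_1)}$, $i=1,2$.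
   Formalization: The pdf f is additionally assumed to equal the left or right derivative of the cdf F at every t > 0; for an arbitrary version of the pdf the claim fails, e.g. X uniform on (0,1) with f(1/2) changed to 100. *)

theory Defs
  imports "HOL-Probability.Probability"
begin

definition interval_domain :: "(real \<Rightarrow> real) \<Rightarrow> (real \<times> real) set" where
  "interval_domain F = {(u, v). 0 \<le> u \<and> 0 \<le> v \<and> F u < F v}"

text \<open>
  The integrand is non-negative on the range of integration (as \<open>0 \<le> t1\<close>), so its
  Lebesgue integral always exists in \<open>[0, \<infinity>]\<close>. The extropy is therefore
  taken in the extended reals, with value \<open>-\<infinity>\<close> when the integral diverges; a
  real-valued Bochner integral would instead return \<open>0\<close> in that case.
\<close>

definition weighted_interval_extropy ::
    "(real \<Rightarrow> real) \<Rightarrow> (real \<Rightarrow> real) \<Rightarrow> real \<Rightarrow> real \<Rightarrow> ereal" where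
  "weighted_interval_extropy F f t1 t2 =
     - (ereal (1 / (2 * (F t2 - F t1)\<^sup>2)) *
        enn2ereal (\<integral>\<^sup>+x\<in>{t1..t2}. ennreal (x * (f x)\<^sup>2) \<partial>lborel))"

definition gen_failure_rate2 ::
    "(real \<Rightarrow> real) \<Rightarrow> (real \<Rightarrow> real) \<Rightarrow> real \<Rightarrow> real \<Rightarrow> real" where
  "gen_failure_rate2 F f t1 t2 = f t2 / (F t2 - F t1)"

text \<open>
  A density is determined only up to null sets, whereas pointwise statements about the
  failure rate depend on its value at each single point. The following fixes an admissible
  version: at every positive point the density is a one-sided derivative of the distribution
  function. Every version that is left- or right-continuous at
  each positive point qualifies, so continuous densities and, for instance, the uniform
  density on a closed or open interval (with jumps at the endpoints) are covered.
\<close>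

definition one_sided_derivative_version :: "(real \<Rightarrow> real) \<Rightarrow> (real \<Rightarrow> real) \<Rightarrow> bool" where
  "one_sided_derivative_version F f \<longleftrightarrow>
     (\<forall>t>0. (F has_real_derivative f t) (at_left t) \<or> (F has_real_derivative f t) (at_right t))"

end

theory Submission
  imports Defs
begin

text \<open>
  Write \<open>I t\<close> for the integral of \<open>x * (f x)\<^sup>2\<close> over \<open>{t1..t}\<close> and \<open>G t = F t - F t1\<close>. Monotonicity says
  that \<open>I / G\<^sup>2\<close> is non-increasing, so if \<open>I t2\<close> is finite then, with \<open>K = I t2 / (G t2)\<^sup>2\<close>, the increments of \<open>I\<close>
  at \<open>t2\<close> are dominated by those of \<open>K * G\<^sup>2\<close>. As \<open>f\<close> need not be continuous, \<open>I\<close> need not be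
  differentiable at \<open>t2\<close>; but integrating \<open>2 * c * f x - c\<^sup>2 \<le> (f x)\<^sup>2\<close> with \<open>c = f t2\<close> bounds its
  increments from below by increments of \<open>F\<close>. Dividing by the step length and passing to the
  one-sided limit gives \<open>t2 * c\<^sup>2 \<le> 2 * K * c * G t2\<close>, which is the claim.
\<close>

text \<open>The cdf difference is the mass of \<open>{s<..t}\<close> under the law of
  \<open>X\<close>, and adding the endpoint \<open>s\<close> adds a Lebesgue null set.\<close>

lemma cdf_increment_eq_nn_integral:
  fixes f :: "real \<Rightarrow> real"
  assumes "prob_space M"
    and pdf: "distributed M lborel X (\<lambda>x. ennreal (f x))"
    and "s \<le> t"
  shows "(\<integral>\<^sup>+x\<in>{s..t}. ennreal (f x) \<partial>lborel) =
           ennreal (cdf (distr M borel X) t - cdf (distr M borel X) s)"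
proof -
  have X: "X \<in> borel_measurable M"
    using distributed_measurable[OF pdf] by simp
  have f: "(\<lambda>x. ennreal (f x)) \<in> borel_measurable lborel"
    using distributed_borel_measurable[OF pdf] by simp
  let ?N = "distr M borel X"
  interpret N: prob_space ?N
    by (rule prob_space.prob_space_distr[OF assms(1) X])
  interpret N: finite_borel_measure ?N
    by unfold_locales auto
  have N: "?N = density lborel (\<lambda>x. ennreal (f x))"
  proof -
    have "?N = distr M lborel X"
      by (rule distr_cong) auto
    then show ?thesis
      using distributed_distr_eq_density[OF pdf] by simp
  qed
  have null: "AE x in lborel. x \<noteq> s"
    by (rule AE_lborel_singleton)
  have "(\<integral>\<^sup>+x\<in>{s..t}. ennreal (f x) \<partial>lborel) = (\<integral>\<^sup>+x\<in>{s<..t}. ennreal (f x) \<partial>lborel)"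
    by (rule nn_integral_cong_AE, use null in eventually_elim) (auto simp: indicator_def)
  also have "\<dots> = emeasure ?N {s<..t}"
    unfolding N by (rule emeasure_density[symmetric]) (use f in auto)
  also have "\<dots> = ennreal (cdf ?N t - cdf ?N s)"
    using N.cdf_diff_eq[of s t] \<open>s \<le> t\<close> by (cases "s = t") (auto simp: N.emeasure_eq_measure)
  finally show ?thesis .
qed

text \<open>On \<open>{s..t}\<close> the weight \<open>x\<close> is at least \<open>s\<close>, so
  the tangent bound for the square at \<open>c\<close> can be integrated with weight
  \<open>s\<close>. Every term stands with a plus sign because the integrals live in
  \<open>ennreal\<close>, where subtraction truncates and infinite values are allowed.\<close>

lemma weighted_square_integral_increment:
  fixes f F :: "real \<Rightarrow> real"
  assumes f_nonneg: "\<And>x. 0 \<le> f x"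
    and f_meas: "f \<in> borel_measurable borel"
    and F: "(\<integral>\<^sup>+x\<in>{s..t}. ennreal (f x) \<partial>lborel) = ennreal (F t - F s)"
    and ord: "0 \<le> r" "r \<le> s" "s \<le> t"
    and "F s \<le> F t" and "0 \<le> c"
  shows "(\<integral>\<^sup>+x\<in>{r..s}. ennreal (x * (f x)\<^sup>2) \<partial>lborel) + ennreal (2 * c * s * (F t - F s))
         \<le> (\<integral>\<^sup>+x\<in>{r..t}. ennreal (x * (f x)\<^sup>2) \<partial>lborel) + ennreal (s * c\<^sup>2 * (t - s))"
proof -
  let ?g = "\<lambda>x. ennreal (x * (f x)\<^sup>2)"
  have [measurable]: "f \<in> borel_measurable borel" by fact
  have "(\<integral>\<^sup>+x\<in>{r..s}. ?g x \<partial>lborel) + ennreal (2 * c * s * (F t - F s))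
      = (\<integral>\<^sup>+x\<in>{r..s}. ?g x \<partial>lborel)
        + ennreal (2 * c * s) * (\<integral>\<^sup>+x\<in>{s..t}. ennreal (f x) \<partial>lborel)"
    using assms by (simp add: ennreal_mult')
  also have "\<dots> = (\<integral>\<^sup>+x. ?g x * indicator {r..s} x
                    + ennreal (2 * c * s) * (ennreal (f x) * indicator {s..t} x) \<partial>lborel)"
    by (subst nn_integral_add) (auto simp: nn_integral_cmult)
  also have "\<dots> \<le> (\<integral>\<^sup>+x. ?g x * indicator {r..t} x
                    + ennreal (s * c\<^sup>2) * indicator {s..t} x \<partial>lborel)"
  proof (rule nn_integral_mono_AE)
    have pw: "2 * c * s * f x \<le> x * (f x)\<^sup>2 + s * c\<^sup>2" if "s \<le> x" for x
    proof -
      have "0 \<le> s * (f x - c)\<^sup>2 + (x - s) * (f x)\<^sup>2"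
        using ord that by simp
      then show ?thesis
        by (simp add: power2_eq_square algebra_simps)
    qed
    \<comment> \<open>The point \<open>s\<close> lies in both \<open>{r..s}\<close> and
      \<open>{s..t}\<close>, and the integrands need not be ordered there.\<close>
    have "AE x in lborel. x \<noteq> s"
      by (rule AE_lborel_singleton)
    then show "AE x in lborel. ?g x * indicator {r..s} x
                    + ennreal (2 * c * s) * (ennreal (f x) * indicator {s..t} x)
               \<le> ?g x * indicator {r..t} x + ennreal (s * c\<^sup>2) * indicator {s..t} x"
    proof eventually_elim
      case (elim x)
      show ?case
      proof (cases "s < x \<and> x \<le> t")
        case True
        then show ?thesis
          using pw[of x] ord \<open>0 \<le> c\<close> f_nonneg[of x]
          by (simp add: indicator_def ennreal_mult'[symmetric] ennreal_plus[symmetric]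
                del: ennreal_plus)
      next
        case False
        then show ?thesis
          using elim ord by (auto simp: indicator_def)
      qed
    qed
  qed
  also have "\<dots> = (\<integral>\<^sup>+x\<in>{r..t}. ?g x \<partial>lborel) + ennreal (s * c\<^sup>2 * (t - s))"
    using ord by (subst nn_integral_add) (auto simp: nn_integral_cmult ennreal_mult')
  finally show ?thesis .
qed

text \<open>Pass to the limit in \<open>bound\<close>: the quotients tend to \<open>c\<close>, and
  \<open>min s t\<close> tends to \<open>t\<close>. Using \<open>min s t\<close>, the left end of
  the interval between \<open>s\<close> and \<open>t\<close>, lets one statement serve approach from
  either side.\<close>

lemma one_sided_difference_quotient_bound:
  fixes F :: "real \<Rightarrow> real"
  assumes deriv: "(F has_real_derivative c) (at t within S)"
    and nontriv: "at t within S \<noteq> bot"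
    and bound: "\<forall>\<^sub>F s in at t within S.
          min s t * (2 * c * ((F s - F t) / (s - t)) - c\<^sup>2)
          \<le> K * ((F s - F t) / (s - t)) * ((F s - F u) + (F t - F u))"
  shows "t * c\<^sup>2 \<le> 2 * K * c * (F t - F u)"
proof -
  have q: "((\<lambda>s. (F s - F t) / (s - t)) \<longlongrightarrow> c) (at t within S)"
    using deriv by (simp add: has_field_derivative_iff)
  have F: "(F \<longlongrightarrow> F t) (at t within S)"
    using DERIV_continuous[OF deriv] by (simp add: continuous_within)
  have id: "((\<lambda>s. s) \<longlongrightarrow> t) (at t within S)"
    by (rule tendsto_ident_at)
  have "min t t * (2 * c * c - c\<^sup>2) \<le> K * c * ((F t - F u) + (F t - F u))"
    by (rule tendsto_le[OF nontriv _ _ bound]) (intro tendsto_intros q F id)+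
  then show ?thesis
    by (simp add: power2_eq_square algebra_simps)
qed

theorem theorem7:
  fixes M :: "'a measure" and X :: "'a \<Rightarrow> real" and f F :: "real \<Rightarrow> real"
  assumes "prob_space M"
    and X_nonneg: "AE \<omega> in M. 0 \<le> X \<omega>"
    and f_nonneg: "\<And>x. 0 \<le> f x"
    and pdf: "distributed M lborel X (\<lambda>x. ennreal (f x))"
    and cdf: "F = cdf (distr M borel X)"
    and version: "one_sided_derivative_version F f"
    and increasing: "\<And>t1. mono_on {t2. (t1, t2) \<in> interval_domain F}
                               (\<lambda>t2. weighted_interval_extropy F f t1 t2)"
  shows "\<forall>(t1, t2) \<in> interval_domain F.
           weighted_interval_extropy F f t1 t2 \<le> ereal (- (t2 * gen_failure_rate2 F f t1 t2) / 4)"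
proof (clarify)
  fix t1 t2 assume dom: "(t1, t2) \<in> interval_domain F"
  have Fint: "(\<integral>\<^sup>+x\<in>{s..t}. ennreal (f x) \<partial>lborel) = ennreal (F t - F s)" if "s \<le> t" for s t
    unfolding cdf by (rule cdf_increment_eq_nn_integral[OF assms(1) pdf that])
  have f_meas: "f \<in> borel_measurable borel"
  proof -
    have "(\<lambda>x. ennreal (f x)) \<in> borel_measurable borel"
      using distributed_borel_measurable[OF pdf] by simp
    then have "(\<lambda>x. enn2real (ennreal (f x))) \<in> borel_measurable borel"
      by measurable
    then show ?thesis
      using f_nonneg by simp
  qed
  have F_mono: "F s \<le> F t" if "s \<le> t" for s t
  proof -
    have X: "X \<in> borel_measurable M"
      using distributed_measurable[OF pdf] by simp
    interpret N: prob_space "distr M borel X"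
      by (rule prob_space.prob_space_distr[OF assms(1) X])
    interpret N: finite_borel_measure "distr M borel X"
      by unfold_locales auto
    show ?thesis
      unfolding cdf by (rule N.cdf_nondecreasing[OF that])
  qed
  have t1: "0 \<le> t1" and G2: "F t1 < F t2"
    using dom by (auto simp: interval_domain_def)
  have t12: "t1 < t2"
    using F_mono[of t2 t1] G2 by linarith
  define I where "I t = (\<integral>\<^sup>+x\<in>{t1..t}. ennreal (x * (f x)\<^sup>2) \<partial>lborel)" for t
  have IJ: "weighted_interval_extropy F f t1 t
              = - (ereal (1 / (2 * (F t - F t1)\<^sup>2)) * enn2ereal (I t))" for t
    by (simp add: weighted_interval_extropy_def I_def)
  have I_mono: "I s \<le> I t" if "s \<le> t" for s t
    unfolding I_def using that
    by (intro nn_integral_mono) (auto simp: indicator_def)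
  have I_antimono: "ereal (1 / (2 * (F t - F t1)\<^sup>2)) * enn2ereal (I t)
        \<le> ereal (1 / (2 * (F s - F t1)\<^sup>2)) * enn2ereal (I s)"
    if "t1 \<le> s" "F t1 < F s" "s \<le> t" for s t
  proof -
    have "weighted_interval_extropy F f t1 s \<le> weighted_interval_extropy F f t1 t"
      using that t1 F_mono[of s t]
      by (intro mono_onD[OF increasing]) (auto simp: interval_domain_def)
    then show ?thesis
      unfolding IJ by simp
  qed
  show "weighted_interval_extropy F f t1 t2 \<le> ereal (- (t2 * gen_failure_rate2 F f t1 t2) / 4)"
  \<comment> \<open>If the integral diverges, its positive factor keeps the product infinite, so the
    extropy is minus infinity.\<close>
  proof (cases "I t2 = \<infinity>")
    case True
    then show ?thesis
      using G2 by (simp add: IJ)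
  next
    case False
    \<comment> \<open>Points beyond \<open>t2\<close> matter when only the right derivative exists.
      There finiteness comes from \<open>I_antimono\<close>, which bounds the scaled integral by its
      finite value at \<open>t2\<close>.\<close>
    have fin: "I t < \<infinity>" if "t1 \<le> t" for t
    proof (cases "t \<le> t2")
      case True
      then show ?thesis
        using I_mono[OF True] False by (simp add: less_top[symmetric] top_unique) (metis top_unique)
    next
      case t: False
      have G: "F t1 < F t"
        using F_mono[of t2 t] G2 t by linarith
      obtain i where i: "I t2 = ennreal i" "0 \<le> i"
        using False by (cases "I t2") auto
      show ?thesis
        using I_antimono[of t2 t] t t12 G2 G i by (cases "I t") auto
    qed
    define i where "i t = enn2real (I t)" for t
    have i: "I t = ennreal (i t)" if "t1 \<le> t" for t
      using fin[OF that] by (simp add: i_def)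
    have i_nonneg: "0 \<le> i t" for t
      by (simp add: i_def)
    have anti: "i t / (F t - F t1)\<^sup>2 \<le> i s / (F s - F t1)\<^sup>2"
      if "t1 \<le> s" "F t1 < F s" "s \<le> t" for s t
      using I_antimono[OF that] that i[of s] i[of t] i_nonneg by simp
    define c where "c = f t2"
    have c: "0 \<le> c"
      by (simp add: c_def f_nonneg)
    have incr: "s * (2 * c * (F t - F s) - c\<^sup>2 * (t - s)) \<le> i t - i s"
      if "t1 \<le> s" "s \<le> t" for s t
    proof -
      have "I s + ennreal (2 * c * s * (F t - F s)) \<le> I t + ennreal (s * c\<^sup>2 * (t - s))"
        unfolding I_def
        by (rule weighted_square_integral_increment[OF f_nonneg f_meas Fint])
           (use that t1 c F_mono in auto)
      then have "i s + 2 * c * s * (F t - F s) \<le> i t + s * c\<^sup>2 * (t - s)"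
        using that t1 c F_mono[of s t] i_nonneg
        by (simp add: i ennreal_plus[symmetric] del: ennreal_plus)
      then show ?thesis
        by (simp add: algebra_simps)
    qed
    define K where "K = i t2 / (F t2 - F t1)\<^sup>2"
    have iK: "i t2 = K * (F t2 - F t1)\<^sup>2"
      using G2 by (simp add: K_def)
    \<comment> \<open>Here \<open>x\<close> is an increment of \<open>F\<close>, \<open>d\<close>
      the step length, and \<open>y\<close> the sum left after factoring a difference of
      squares.\<close>
    have divide_step: "m * (2 * c * (x / d) - c\<^sup>2) \<le> K * (x / d) * y"
      if "m * (2 * c * x - c\<^sup>2 * d) \<le> K * x * y" "0 < d" for m x y d :: real
    proof -
      have "m * (2 * c * x - c\<^sup>2 * d) / d \<le> K * x * y / d"
        using that by (intro divide_right_mono) auto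
      moreover have "m * (2 * c * x - c\<^sup>2 * d) / d = m * (2 * c * (x / d) - c\<^sup>2)"
        using \<open>0 < d\<close> by (simp add: field_simps)
      ultimately show ?thesis
        by simp
    qed
    \<comment> \<open>By \<open>anti\<close>, \<open>K * (F s - F t1)\<^sup>2\<close> is at most
      \<open>i s\<close> to the left of \<open>t2\<close> and at least \<open>i s\<close> to the
      right, with equality at \<open>t2\<close>. Hence on both sides it bounds the increment of
      \<open>i\<close> from above, while \<open>incr\<close> bounds that increment from
      below.\<close>
    have bound: "min s t2 * (2 * c * ((F s - F t2) / (s - t2)) - c\<^sup>2)
          \<le> K * ((F s - F t2) / (s - t2)) * ((F s - F t1) + (F t2 - F t1))"
      if s: "t1 \<le> s" "F t1 < F s" "s \<noteq> t2" for s
    proof (cases "s < t2")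
      case True
      have "K * (F s - F t1)\<^sup>2 \<le> i s"
        using anti[of s t2] s True by (simp add: K_def pos_le_divide_eq)
      then have "s * (2 * c * (F t2 - F s) - c\<^sup>2 * (t2 - s))
            \<le> K * (F t2 - F s) * ((F s - F t1) + (F t2 - F t1))"
        using incr[of s t2] s True unfolding iK by (simp add: power2_eq_square algebra_simps)
      then have "s * (2 * c * ((F t2 - F s) / (t2 - s)) - c\<^sup>2)
            \<le> K * ((F t2 - F s) / (t2 - s)) * ((F s - F t1) + (F t2 - F t1))"
        by (rule divide_step) (use True in simp)
      moreover have "(F s - F t2) / (s - t2) = (F t2 - F s) / (t2 - s)"
        by (metis minus_diff_eq minus_divide_divide)
      ultimately show ?thesis
        using True by (simp only: min_absorb1[OF less_imp_le])
    next
      case False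
      then have st: "t2 < s"
        using s by simp
      have "i s \<le> K * (F s - F t1)\<^sup>2"
        using anti[of t2 s] s st t12 G2 by (simp add: K_def pos_divide_le_eq)
      then have "t2 * (2 * c * (F s - F t2) - c\<^sup>2 * (s - t2))
            \<le> K * (F s - F t2) * ((F s - F t1) + (F t2 - F t1))"
        using incr[of t2 s] st t12 unfolding iK by (simp add: power2_eq_square algebra_simps)
      then have "t2 * (2 * c * ((F s - F t2) / (s - t2)) - c\<^sup>2)
            \<le> K * ((F s - F t2) / (s - t2)) * ((F s - F t1) + (F t2 - F t1))"
        by (rule divide_step) (use st in simp)
      then show ?thesis
        using st by (simp only: min_absorb2[OF less_imp_le])
    qed
    \<comment> \<open>A general \<open>S\<close> covers \<open>at_left\<close> and
      \<open>at_right\<close> at once. Differentiability within \<open>S\<close> gives continuity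
      there, which keeps \<open>F t1 < F s\<close> near \<open>t2\<close>.\<close>
    have main: "t2 * c\<^sup>2 \<le> 2 * K * c * (F t2 - F t1)"
      if deriv: "(F has_real_derivative c) (at t2 within S)" and "at t2 within S \<noteq> bot" for S
    proof (rule one_sided_difference_quotient_bound[OF that])
      have "(F \<longlongrightarrow> F t2) (at t2 within S)"
        using DERIV_continuous[OF deriv] by (simp add: continuous_within)
      then have "\<forall>\<^sub>F s in at t2 within S. F t1 < F s"
        by (rule order_tendstoD) (rule G2)
      moreover have "\<forall>\<^sub>F s in at t2 within S. t1 < s"
        by (rule order_tendstoD[OF tendsto_ident_at t12])
      moreover have "\<forall>\<^sub>F s in at t2 within S. s \<noteq> t2"
        by (simp add: eventually_at_filter)
      ultimately show "\<forall>\<^sub>F s in at t2 within S.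
          min s t2 * (2 * c * ((F s - F t2) / (s - t2)) - c\<^sup>2)
          \<le> K * ((F s - F t2) / (s - t2)) * ((F s - F t1) + (F t2 - F t1))"
        by eventually_elim (rule bound, auto)
    qed
    have "(F has_real_derivative c) (at_left t2) \<or> (F has_real_derivative c) (at_right t2)"
      using version t1 t12 unfolding one_sided_derivative_version_def c_def by auto
    then have "t2 * c\<^sup>2 \<le> 2 * K * c * (F t2 - F t1)"
      using main by (auto simp: trivial_limit_at_left_real trivial_limit_at_right_real)
    then have "c * (t2 * c) \<le> c * (2 * K * (F t2 - F t1))"
      by (simp add: power2_eq_square algebra_simps)
    \<comment> \<open>This settles the case \<open>c = 0\<close>, in which \<open>c\<close> cannot
      be cancelled.\<close>
    moreover have "0 \<le> K * (F t2 - F t1)"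
      using G2 i_nonneg by (simp add: K_def)
    ultimately have "t2 * c \<le> 2 * K * (F t2 - F t1)"
      using c by (cases "c = 0") auto
    then have "t2 * (c / (F t2 - F t1)) / 4 \<le> K / 2"
      using G2 by (simp add: field_simps)
    moreover have "weighted_interval_extropy F f t1 t2 = ereal (- (K / 2))"
      using i[of t2] i_nonneg t12 by (simp add: IJ K_def)
    ultimately show ?thesis
      by (simp add: gen_failure_rate2_def c_def)
  qed
qed

end
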